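(* Let $\Gamma$ be a multiset of $D$-formulas and let $G$ be a $G$-formula. Then the sequent $\Gamma \longrightarrow G$ has a C-proof (a classical sequent calculus proof) if and only if it has an $\mathbf{I}_G$-proof.
   Context: We work in first-order logic with primitive logical symbols $\top,\bot,\land,\lor,\supset,\exists,\forall$ ($\neg A$ abbreviates $A\supset\bot$). A sequent $\Gamma\longrightarrow\Delta$ is a pair of multisets of formulas; it is an axiom if $\top\in\Delta$, or if some formula $A$ that is $\bot$ or atomic lies in both $\Gamma$ and $\Delta$. The sequent rules are: contraction on the left and on the right; $\bot$-R (from $\Gamma\longrightarrow\Delta,\bot$ infer $\Gamma\longrightarrow\Delta,D$); $\land$-L (from $B,D,B\land D,\Gamma\longrightarrow\Delta$ infer $B\land D,\Gamma\longrightarrow\Delta$); $\land$-R; $\lor$-L (from $B,\Gamma\longrightarrow\Delta$ and $D,\Gamma\longrightarrow\Delta$ infer $B\lor D,\Gamma\longrightarrow\Delta$); the two $\lor$-R rules; $\supset$-L (from $B\supset D,\Gamma\longrightarrow B,\Delta$ and $D,\Gamma\longrightarrow\Theta$ infer $B\supset D,\Gamma\longrightarrow\Delta,\Theta$); $\supset$-R (from $B,\Gamma\longrightarrow\Delta,D$ infer $\Gamma\longrightarrow\Delta,B\supset D$); $\forall$-L (from $[t/x]B,\forall x B,\Gamma\longrightarrow\Delta$ infer $\forall x B,\Gamma\longrightarrow\Delta$); $\exists$-R (from $\Gamma\longrightarrow\Delta,[t/x]B$ infer $\Gamma\longrightarrow\Delta,\exists x B$); $\exists$-L and $\forall$-R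 with a constant $c$ replacing $x$, under the proviso that $c$ does not occur in the lower sequent. A C-proof is a derivation using these rules arbitrarily; an I-proof is a C-proof in which every sequent has exactly one formula in its succedent. $G$-formulas and $D$-formulas are given by the grammar (with $A$ atomic) $G ::= \top \mid \bot \mid A \mid G\land G \mid G\lor G \mid D\supset G \mid \exists x\, G$, $D ::= \top \mid \bot \mid A \mid G\supset D \mid D\land D \mid D\lor D \mid \exists x\, D \mid \forall x\, D$; so universal quantifiers do not occur positively in $G$-formulas or negatively in $D$-formulas. Fix the $G$-formula $G$ of the end sequent. The $\mathbf{I}_G$ calculus is the single-succedent (intuitionistic) sequent calculus above, modified by adding the two rules $\lor$-L$_G$: from $B,\Delta\longrightarrow F$ and $D,\Delta\longrightarrow G$ infer $B\lor D,\Delta\longrightarrow F$; res$_G$: from $\Delta\longrightarrow G$ infer $\Delta\longrightarrow F$; and by strengthening the proviso on $\exists$-L and $\forall$-R so that the new constant also may not appear in $G$. An $\mathbf{I}_G$-proof is a derivation in this calculus that, moreover, contains no occurrences of the ordinary $\lor$-L rule (this rule is shown redundant for such sequents: any $\lor$-L occurrence can be eliminated in favour of $\lor$-L$_G$). These two rules are derived intuitionistic rules when the antecedent contains $G\supset\bot$, so $\mathbf{I}_G$-proofs implicitly represent I-proofs of $G\supset\bot,\Gamma\longrightarrow G$. *)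

theory Defs
  imports "HOL-Library.Multiset"
begin

(* Bound and free variables are de Bruijn indices.  A function or predicate symbol is a name together
   with the number of arguments it is applied to; a term Fun f [] is merely one more closed term,
   and eigenconstants are always of the form Const c.  The set functions consts_tm and consts_fm
   generated by the datatype package yield the constants occurring in a term or formula. *)

datatype (consts_tm: 'c, 'f) tm =
    Var nat
  | Const 'c
  | Fun 'f "('c, 'f) tm list"

datatype (consts_fm: 'c, 'f, 'p) fm =
    Top
  | Bot
  | Atom 'p "('c, 'f) tm list"
  | And "('c, 'f, 'p) fm" "('c, 'f, 'p) fm"
  | Or "('c, 'f, 'p) fm" "('c, 'f, 'p) fm"
  | Imp "('c, 'f, 'p) fm" "('c, 'f, 'p) fm"
  | Exists "('c, 'f, 'p) fm"
  | Forall "('c, 'f, 'p) fm"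

primrec lift_tm :: "('c, 'f) tm \<Rightarrow> ('c, 'f) tm" where
  "lift_tm (Var n) = Var (Suc n)"
| "lift_tm (Const c) = Const c"
| "lift_tm (Fun f ts) = Fun f (map lift_tm ts)"

primrec subst_tm :: "nat \<Rightarrow> ('c, 'f) tm \<Rightarrow> ('c, 'f) tm \<Rightarrow> ('c, 'f) tm" where
  "subst_tm k t (Var n) = (if n < k then Var n else if n = k then t else Var (n - 1))"
| "subst_tm k t (Const c) = Const c"
| "subst_tm k t (Fun f ts) = Fun f (map (subst_tm k t) ts)"

primrec subst_fm :: "nat \<Rightarrow> ('c, 'f) tm \<Rightarrow> ('c, 'f, 'p) fm \<Rightarrow> ('c, 'f, 'p) fm" where
  "subst_fm k t Top = Top"
| "subst_fm k t Bot = Bot"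
| "subst_fm k t (Atom p ts) = Atom p (map (subst_tm k t) ts)"
| "subst_fm k t (And A B) = And (subst_fm k t A) (subst_fm k t B)"
| "subst_fm k t (Or A B) = Or (subst_fm k t A) (subst_fm k t B)"
| "subst_fm k t (Imp A B) = Imp (subst_fm k t A) (subst_fm k t B)"
| "subst_fm k t (Exists A) = Exists (subst_fm (Suc k) (lift_tm t) A)"
| "subst_fm k t (Forall A) = Forall (subst_fm (Suc k) (lift_tm t) A)"

(* The body B of a quantified formula with its bound variable replaced by t. *)
abbreviation inst :: "('c, 'f) tm \<Rightarrow> ('c, 'f, 'p) fm \<Rightarrow> ('c, 'f, 'p) fm" where
  "inst t B \<equiv> subst_fm 0 t B"

fun G_formula :: "('c, 'f, 'p) fm \<Rightarrow> bool" and D_formula :: "('c, 'f, 'p) fm \<Rightarrow> bool" where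
  "G_formula Top = True"
| "G_formula Bot = True"
| "G_formula (Atom p ts) = True"
| "G_formula (And A B) = (G_formula A \<and> G_formula B)"
| "G_formula (Or A B) = (G_formula A \<and> G_formula B)"
| "G_formula (Imp A B) = (D_formula A \<and> G_formula B)"
| "G_formula (Exists A) = G_formula A"
| "G_formula (Forall A) = False"
| "D_formula Top = True"
| "D_formula Bot = True"
| "D_formula (Atom p ts) = True"
| "D_formula (And A B) = (D_formula A \<and> D_formula B)"
| "D_formula (Or A B) = (D_formula A \<and> D_formula B)"
| "D_formula (Imp A B) = (G_formula A \<and> D_formula B)"
| "D_formula (Exists A) = D_formula A"
| "D_formula (Forall A) = D_formula A"

datatype ('c, 'f, 'p) sequent =
  Sequent (antecedent: "('c, 'f, 'p) fm multiset") (succedent: "('c, 'f, 'p) fm multiset")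
    (infix "\<turnstile>" 55)

definition consts_seq :: "('c, 'f, 'p) sequent \<Rightarrow> 'c set" where
  "consts_seq s = (\<Union>A \<in> set_mset (antecedent s + succedent s). consts_fm A)"

fun bot_or_atomic :: "('c, 'f, 'p) fm \<Rightarrow> bool" where
  "bot_or_atomic Bot = True"
| "bot_or_atomic (Atom p ts) = True"
| "bot_or_atomic _ = False"

definition axiom_seq :: "('c, 'f, 'p) sequent \<Rightarrow> bool" where
  "axiom_seq s \<longleftrightarrow> Top \<in># succedent s \<or>
     (\<exists>A. bot_or_atomic A \<and> A \<in># antecedent s \<and> A \<in># succedent s)"

(* rule X ps s: s follows from the list of premises ps by one of the rules other than \<or>-L.
   The constants in X are excluded, in addition to those of the lower sequent, as
   eigenconstants of \<exists>-L and \<forall>-R. *)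

inductive rule ::
  "'c set \<Rightarrow> ('c, 'f, 'p) sequent list \<Rightarrow> ('c, 'f, 'p) sequent \<Rightarrow> bool" for X where
  contr_L: "rule X [add_mset B (add_mset B \<Gamma>) \<turnstile> \<Delta>] (add_mset B \<Gamma> \<turnstile> \<Delta>)"
| contr_R: "rule X [\<Gamma> \<turnstile> add_mset B (add_mset B \<Delta>)] (\<Gamma> \<turnstile> add_mset B \<Delta>)"
| bot_R: "rule X [\<Gamma> \<turnstile> add_mset Bot \<Delta>] (\<Gamma> \<turnstile> add_mset D \<Delta>)"
| and_L: "rule X [add_mset B (add_mset D (add_mset (And B D) \<Gamma>)) \<turnstile> \<Delta>]
    (add_mset (And B D) \<Gamma> \<turnstile> \<Delta>)"
| and_R: "rule X [\<Gamma> \<turnstile> add_mset B \<Delta>, \<Gamma> \<turnstile> add_mset D \<Delta>] (\<Gamma> \<turnstile> add_mset (And B D) \<Delta>)"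
| or_R1: "rule X [\<Gamma> \<turnstile> add_mset B \<Delta>] (\<Gamma> \<turnstile> add_mset (Or B D) \<Delta>)"
| or_R2: "rule X [\<Gamma> \<turnstile> add_mset D \<Delta>] (\<Gamma> \<turnstile> add_mset (Or B D) \<Delta>)"
| imp_L: "rule X [add_mset (Imp B D) \<Gamma> \<turnstile> add_mset B \<Delta>, add_mset D \<Gamma> \<turnstile> \<Theta>]
    (add_mset (Imp B D) \<Gamma> \<turnstile> \<Delta> + \<Theta>)"
| imp_R: "rule X [add_mset B \<Gamma> \<turnstile> add_mset D \<Delta>] (\<Gamma> \<turnstile> add_mset (Imp B D) \<Delta>)"
| forall_L: "rule X [add_mset (inst t B) (add_mset (Forall B) \<Gamma>) \<turnstile> \<Delta>]
    (add_mset (Forall B) \<Gamma> \<turnstile> \<Delta>)"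
| forall_R: "c \<notin> consts_seq (\<Gamma> \<turnstile> add_mset (Forall B) \<Delta>) \<Longrightarrow> c \<notin> X \<Longrightarrow>
    rule X [\<Gamma> \<turnstile> add_mset (inst (Const c) B) \<Delta>] (\<Gamma> \<turnstile> add_mset (Forall B) \<Delta>)"
| exists_L: "c \<notin> consts_seq (add_mset (Exists B) \<Gamma> \<turnstile> \<Delta>) \<Longrightarrow> c \<notin> X \<Longrightarrow>
    rule X [add_mset (inst (Const c) B) \<Gamma> \<turnstile> \<Delta>] (add_mset (Exists B) \<Gamma> \<turnstile> \<Delta>)"
| exists_R: "rule X [\<Gamma> \<turnstile> add_mset (inst t B) \<Delta>] (\<Gamma> \<turnstile> add_mset (Exists B) \<Delta>)"

inductive C_provable :: "('c, 'f, 'p) sequent \<Rightarrow> bool" where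
  axiom: "axiom_seq s \<Longrightarrow> C_provable s"
| rule: "rule {} ps s \<Longrightarrow> \<forall>p \<in> set ps. C_provable p \<Longrightarrow> C_provable s"
| or_L: "C_provable (add_mset B \<Gamma> \<turnstile> \<Delta>) \<Longrightarrow> C_provable (add_mset D \<Gamma> \<turnstile> \<Delta>) \<Longrightarrow>
    C_provable (add_mset (Or B D) \<Gamma> \<turnstile> \<Delta>)"

(* Every sequent in an I_G-proof has exactly one succedent formula; \<or>-L is not available. *)
inductive IG_provable :: "('c, 'f, 'p) fm \<Rightarrow> ('c, 'f, 'p) sequent \<Rightarrow> bool" for G where
  axiom: "axiom_seq s \<Longrightarrow> size (succedent s) = 1 \<Longrightarrow> IG_provable G s"
| rule: "rule (consts_fm G) ps s \<Longrightarrow> size (succedent s) = 1 \<Longrightarrow>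
    \<forall>p \<in> set ps. IG_provable G p \<Longrightarrow> IG_provable G s"
| or_LG: "IG_provable G (add_mset B \<Delta> \<turnstile> {#F#}) \<Longrightarrow> IG_provable G (add_mset D \<Delta> \<turnstile> {#G#}) \<Longrightarrow>
    IG_provable G (add_mset (Or B D) \<Delta> \<turnstile> {#F#})"
| res_G: "IG_provable G (\<Delta> \<turnstile> {#G#}) \<Longrightarrow> IG_provable G (\<Delta> \<turnstile> {#F#})"

end

theory Submission imports Defs begin

text \<open>A classical proof is read in continuation-passing style.  Call a formula \<open>A\<close> refuted in a
  context \<open>\<Gamma>\<close> if every extension of \<open>\<Gamma>\<close> that proves \<open>A\<close> in \<open>I\<^sub>G\<close> also proves \<open>G\<close>.  If
  \<open>\<Gamma> \<longrightarrow> \<Delta>\<close> is classically provable without \<open>\<forall>\<close>-R, then \<open>G\<close> is provable in every context that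
  extends \<open>\<Gamma>\<close> and refutes all formulas of \<open>\<Delta>\<close>; the rule \<open>res\<^sub>G\<close> is what makes this go through
  for \<open>\<supset>\<close>-R.  The rule \<open>\<forall>\<close>-R does not occur, since the sequents in a proof of \<open>\<Gamma> \<longrightarrow> G\<close> contain
  only \<open>D\<close>-formulas on the left and \<open>G\<close>-formulas on the right.  Conversely, an \<open>I\<^sub>G\<close>-proof
  becomes classical once \<open>G\<close> is added to all succedents.\<close>

section \<open>Renaming of constants\<close>

abbreviation rename_tm :: "('c \<Rightarrow> 'c) \<Rightarrow> ('c, 'f) tm \<Rightarrow> ('c, 'f) tm" where
  "rename_tm \<rho> \<equiv> map_tm \<rho> (\<lambda>f. f)"

abbreviation rename_fm :: "('c \<Rightarrow> 'c) \<Rightarrow> ('c, 'f, 'p) fm \<Rightarrow> ('c, 'f, 'p) fm" where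
  "rename_fm \<rho> \<equiv> map_fm \<rho> (\<lambda>f. f) (\<lambda>p. p)"

lemma rename_lift_tm: "rename_tm \<rho> (lift_tm t) = lift_tm (rename_tm \<rho> t)"
  by (induction t) auto

lemma rename_subst_tm:
  "rename_tm \<rho> (subst_tm k t s) = subst_tm k (rename_tm \<rho> t) (rename_tm \<rho> s)"
  by (induction s) auto

lemma rename_subst_fm:
  "rename_fm \<rho> (subst_fm k t A) = subst_fm k (rename_tm \<rho> t) (rename_fm \<rho> A)"
  by (induction A arbitrary: k t) (auto simp: rename_subst_tm rename_lift_tm)

lemma rename_fm_cong:
  "(\<And>c. c \<in> consts_fm A \<Longrightarrow> \<rho> c = \<sigma> c) \<Longrightarrow> rename_fm \<rho> A = rename_fm \<sigma> A"
  by (rule fm.map_cong) auto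

text \<open>When an eigenconstant is redirected to a fresh constant, its proviso makes this
  applicable to all side formulas.\<close>

lemma rename_fm_upd: "c \<notin> consts_fm A \<Longrightarrow> rename_fm (\<rho>(c := d)) A = rename_fm \<rho> A"
  by (rule rename_fm_cong) auto

lemma rename_fm_fixed:
  assumes "\<forall>c \<in> consts_fm A. \<rho> c = c"
  shows "rename_fm \<rho> A = A"
proof -
  have "rename_fm \<rho> A = rename_fm (\<lambda>c. c) A"
    using assms by (intro rename_fm_cong) simp
  then show ?thesis by (simp add: fm.map_ident)
qed

section \<open>Supply of fresh constants\<close>

lemma finite_consts_tm: "finite (consts_tm t)"
  by (induction t) auto

lemma finite_consts_fm: "finite (consts_fm A)"
  by (induction A) (auto simp: finite_consts_tm)

lemma consts_seq_simps:
  "c \<in> consts_seq (\<Gamma> \<turnstile> \<Delta>) \<longleftrightarrow> (\<exists>A \<in># \<Gamma>. c \<in> consts_fm A) \<or> (\<exists>A \<in># \<Delta>. c \<in> consts_fm A)"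
  by (auto simp: consts_seq_def)

lemma fresh_constant:
  assumes "infinite (UNIV :: 'c set)"
  obtains c :: 'c where "c \<notin> consts_seq s" "c \<notin> consts_fm G"
proof -
  have "finite (consts_seq s \<union> consts_fm G)"
    by (auto simp: consts_seq_def finite_consts_fm)
  then show ?thesis
    using that ex_new_if_finite[OF assms] by blast
qed

text \<open>Both classes depend only on the logical skeleton, which substitution inside atoms leaves
  alone. Hence reading a quantifier rule upwards stays within them.\<close>

lemma G_D_formula_subst_fm:
  "G_formula (subst_fm k t A) = G_formula A \<and> D_formula (subst_fm k t A) = D_formula A"
  by (induction A arbitrary: k t) auto

section \<open>Derived rules\<close>

lemma C_contr_R:
  "C_provable (\<Gamma> \<turnstile> add_mset B (add_mset B \<Delta>)) \<Longrightarrow> C_provable (\<Gamma> \<turnstile> add_mset B \<Delta>)"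
  by (rule C_provable.rule, rule rule.contr_R) simp

lemma C_bot_R: "C_provable (\<Gamma> \<turnstile> add_mset Bot \<Delta>) \<Longrightarrow> C_provable (\<Gamma> \<turnstile> add_mset D \<Delta>)"
  by (rule C_provable.rule, rule rule.bot_R) simp

lemma IG_rule:
  "rule (consts_fm G) ps (\<Gamma> \<turnstile> {#F#}) \<Longrightarrow> \<forall>p \<in> set ps. IG_provable G p \<Longrightarrow>
    IG_provable G (\<Gamma> \<turnstile> {#F#})"
  by (rule IG_provable.rule) auto

lemma IG_provable_size: "IG_provable G s \<Longrightarrow> size (succedent s) = 1"
  by (induction rule: IG_provable.induct) auto

lemma IG_provable_succedent: "IG_provable G (\<Gamma> \<turnstile> add_mset B \<Delta>) \<Longrightarrow> \<Delta> = {#}"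
  using IG_provable_size[of G "\<Gamma> \<turnstile> add_mset B \<Delta>"] by simp

section \<open>Induction over single-succedent proofs\<close>

text \<open>The generated induction treats all of \<open>rule\<close> as one case with premise lists
  and succedent multisets. Since every succedent is a singleton, it splits into one case per rule
  over a context and a formula.\<close>

lemma IG_induct [consumes 1, case_names axiom contr_L bot_R and_L and_R or_R1 or_R2 imp_L imp_R
    forall_L forall_R exists_L exists_R or_LG res_G]:
  assumes "IG_provable G (\<Gamma> \<turnstile> {#F#})"
    and "\<And>\<Gamma> F. axiom_seq (\<Gamma> \<turnstile> {#F#}) \<Longrightarrow> P \<Gamma> F"
    and "\<And>B \<Gamma> F. P (add_mset B (add_mset B \<Gamma>)) F \<Longrightarrow> P (add_mset B \<Gamma>) F"
    and "\<And>\<Gamma> F. P \<Gamma> Bot \<Longrightarrow> P \<Gamma> F"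
    and "\<And>B D \<Gamma> F. P (add_mset B (add_mset D (add_mset (And B D) \<Gamma>))) F \<Longrightarrow>
      P (add_mset (And B D) \<Gamma>) F"
    and "\<And>\<Gamma> B D. P \<Gamma> B \<Longrightarrow> P \<Gamma> D \<Longrightarrow> P \<Gamma> (And B D)"
    and "\<And>\<Gamma> B D. P \<Gamma> B \<Longrightarrow> P \<Gamma> (Or B D)"
    and "\<And>\<Gamma> B D. P \<Gamma> D \<Longrightarrow> P \<Gamma> (Or B D)"
    and "\<And>B D \<Gamma> F. P (add_mset (Imp B D) \<Gamma>) B \<Longrightarrow> P (add_mset D \<Gamma>) F \<Longrightarrow>
      P (add_mset (Imp B D) \<Gamma>) F"
    and "\<And>B D \<Gamma>. P (add_mset B \<Gamma>) D \<Longrightarrow> P \<Gamma> (Imp B D)"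
    and "\<And>t B \<Gamma> F. P (add_mset (inst t B) (add_mset (Forall B) \<Gamma>)) F \<Longrightarrow>
      P (add_mset (Forall B) \<Gamma>) F"
    and "\<And>c \<Gamma> B. c \<notin> consts_seq (\<Gamma> \<turnstile> {#Forall B#}) \<Longrightarrow> c \<notin> consts_fm G \<Longrightarrow>
      P \<Gamma> (inst (Const c) B) \<Longrightarrow> P \<Gamma> (Forall B)"
    and "\<And>c B \<Gamma> F. c \<notin> consts_seq (add_mset (Exists B) \<Gamma> \<turnstile> {#F#}) \<Longrightarrow> c \<notin> consts_fm G \<Longrightarrow>
      P (add_mset (inst (Const c) B) \<Gamma>) F \<Longrightarrow> P (add_mset (Exists B) \<Gamma>) F"
    and "\<And>\<Gamma> t B. P \<Gamma> (inst t B) \<Longrightarrow> P \<Gamma> (Exists B)"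
    and "\<And>B D \<Gamma> F. P (add_mset B \<Gamma>) F \<Longrightarrow> P (add_mset D \<Gamma>) G \<Longrightarrow> P (add_mset (Or B D) \<Gamma>) F"
    and "\<And>\<Gamma> F. P \<Gamma> G \<Longrightarrow> P \<Gamma> F"
  shows "P \<Gamma> F"
proof -
  have "\<forall>\<Gamma> F. s = \<Gamma> \<turnstile> {#F#} \<longrightarrow> P \<Gamma> F" if "IG_provable G s" for s
    using that
  proof (induction rule: IG_provable.induct)
    case (axiom s)
    then show ?case by clarsimp (rule assms(2))
  next
    case (rule ps s)
    have prem: "IG_provable G p" if "p \<in> set ps" for p
      using rule(3) that by blast
    have IH: "P \<Gamma> F" if "\<Gamma> \<turnstile> {#F#} \<in> set ps" for \<Gamma> F
      using rule(3) that by blast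
    have "P \<Gamma> F" if "s = \<Gamma> \<turnstile> {#F#}" for \<Gamma> F
      using rule(1)
    proof cases
      case (imp_L B D \<Gamma>' \<Delta> \<Theta>)
      \<comment> \<open>The left premise has succedent \<open>add_mset B \<Delta>\<close>, which
        must be a singleton, so \<open>F\<close> comes from the right premise alone.\<close>
      have "\<Delta> = {#}"
        by (rule IG_provable_succedent[of G "add_mset (Imp B D) \<Gamma>'" B], rule prem)
          (simp add: imp_L)
      then have "P (add_mset (Imp B D) \<Gamma>') B" "P (add_mset D \<Gamma>') F"
        using imp_L that by (auto intro: IH)
      then have "P (add_mset (Imp B D) \<Gamma>') F" by (rule assms(9))
      then show ?thesis using imp_L(2) that by simp
    next
      case (contr_R \<Gamma>' B \<Delta>)
      \<comment> \<open>The premise would contain \<open>B\<close> twice on the right, so right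
        contraction cannot occur.\<close>
      then have "add_mset B \<Delta> = {#}"
        by (intro IG_provable_succedent[of G \<Gamma>' B] prem) simp
      then show ?thesis by simp
    next
      case contr_L
      with that show ?thesis by clarsimp (rule assms(3); (rule IH)?; simp)
    next
      case bot_R
      with that show ?thesis by clarsimp (rule assms(4); (rule IH)?; simp)
    next
      case and_L
      with that show ?thesis by clarsimp (rule assms(5); (rule IH)?; simp)
    next
      case and_R
      with that show ?thesis by clarsimp (rule assms(6); (rule IH)?; simp)
    next
      case or_R1
      with that show ?thesis by clarsimp (rule assms(7); (rule IH)?; simp)
    next
      case or_R2
      with that show ?thesis by clarsimp (rule assms(8); (rule IH)?; simp)
    next
      case imp_R
      with that show ?thesis by clarsimp (rule assms(10); (rule IH)?; simp)
    next
      case forall_L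
      with that show ?thesis by clarsimp (rule assms(11); (rule IH)?; simp)
    next
      case forall_R
      with that show ?thesis by clarsimp (rule assms(12); (rule IH)?; simp)
    next
      case exists_L
      with that show ?thesis by clarsimp (rule assms(13); (rule IH)?; simp)
    next
      case exists_R
      with that show ?thesis by clarsimp (rule assms(14); (rule IH)?; simp)
    qed
    then show ?case by blast
  next
    case or_LG
    then show ?case by clarsimp (rule assms(15))
  next
    case res_G
    then show ?case by clarsimp (rule assms(16))
  qed
  from this[OF assms(1)] show ?thesis by simp
qed

section \<open>Rules of the calculus in cumulative form\<close>

text \<open>Contraction lets the left rules below take a principal formula that is merely a member
  of the context and keep it there, so that contexts only grow upwards and can be compared as
  sets.\<close>

lemma IG_contr_L:
  assumes "A \<in># \<Gamma>" "IG_provable G (add_mset A \<Gamma> \<turnstile> {#F#})"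
  shows "IG_provable G (\<Gamma> \<turnstile> {#F#})"
proof -
  from multi_member_split[OF assms(1)] obtain \<Gamma>1 where \<Gamma>: "\<Gamma> = add_mset A \<Gamma>1" ..
  show ?thesis
    unfolding \<Gamma> by (rule IG_rule, rule rule.contr_L) (use assms(2) \<Gamma> in auto)
qed

lemma IG_bot_R: "IG_provable G (\<Gamma> \<turnstile> {#Bot#}) \<Longrightarrow> IG_provable G (\<Gamma> \<turnstile> {#F#})"
  by (rule IG_rule, rule rule.bot_R) auto

lemma IG_and_L:
  assumes "And B D \<in># \<Gamma>" "IG_provable G (add_mset B (add_mset D \<Gamma>) \<turnstile> {#F#})"
  shows "IG_provable G (\<Gamma> \<turnstile> {#F#})"
proof -
  from multi_member_split[OF assms(1)] obtain \<Gamma>1 where \<Gamma>: "\<Gamma> = add_mset (And B D) \<Gamma>1" ..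
  show ?thesis
    unfolding \<Gamma> by (rule IG_rule, rule rule.and_L) (use assms(2) \<Gamma> in auto)
qed

lemma IG_and_R:
  "IG_provable G (\<Gamma> \<turnstile> {#B#}) \<Longrightarrow> IG_provable G (\<Gamma> \<turnstile> {#D#}) \<Longrightarrow> IG_provable G (\<Gamma> \<turnstile> {#And B D#})"
  by (rule IG_rule, rule rule.and_R) auto

lemma IG_or_R1: "IG_provable G (\<Gamma> \<turnstile> {#B#}) \<Longrightarrow> IG_provable G (\<Gamma> \<turnstile> {#Or B D#})"
  by (rule IG_rule, rule rule.or_R1) auto

lemma IG_or_R2: "IG_provable G (\<Gamma> \<turnstile> {#D#}) \<Longrightarrow> IG_provable G (\<Gamma> \<turnstile> {#Or B D#})"
  by (rule IG_rule, rule rule.or_R2) auto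

lemma IG_imp_L:
  assumes "Imp B D \<in># \<Gamma>" "IG_provable G (add_mset (Imp B D) \<Gamma> \<turnstile> {#B#})"
    and "IG_provable G (add_mset D \<Gamma> \<turnstile> {#F#})"
  shows "IG_provable G (\<Gamma> \<turnstile> {#F#})"
proof (rule IG_contr_L[OF assms(1)])
  show "IG_provable G (add_mset (Imp B D) \<Gamma> \<turnstile> {#F#})"
    by (rule IG_rule, rule rule.imp_L[where \<Delta> = "{#}", simplified]) (use assms(2,3) in auto)
qed

lemma IG_imp_R: "IG_provable G (add_mset B \<Gamma> \<turnstile> {#D#}) \<Longrightarrow> IG_provable G (\<Gamma> \<turnstile> {#Imp B D#})"
  by (rule IG_rule, rule rule.imp_R) auto

lemma IG_forall_L:
  assumes "Forall B \<in># \<Gamma>" "IG_provable G (add_mset (inst t B) \<Gamma> \<turnstile> {#F#})"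
  shows "IG_provable G (\<Gamma> \<turnstile> {#F#})"
proof -
  from multi_member_split[OF assms(1)] obtain \<Gamma>1 where \<Gamma>: "\<Gamma> = add_mset (Forall B) \<Gamma>1" ..
  show ?thesis
    unfolding \<Gamma> by (rule IG_rule, rule rule.forall_L) (use assms(2) \<Gamma> in auto)
qed

lemma IG_forall_R:
  assumes "c \<notin> consts_seq (\<Gamma> \<turnstile> {#Forall B#})" "c \<notin> consts_fm G"
    and "IG_provable G (\<Gamma> \<turnstile> {#inst (Const c) B#})"
  shows "IG_provable G (\<Gamma> \<turnstile> {#Forall B#})"
  by (rule IG_rule, rule rule.forall_R) (use assms in auto)

lemma IG_exists_L:
  assumes "Exists B \<in># \<Gamma>" "c \<notin> consts_seq (\<Gamma> \<turnstile> {#F#})" "c \<notin> consts_fm G"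
    and "IG_provable G (add_mset (inst (Const c) B) \<Gamma> \<turnstile> {#F#})"
  shows "IG_provable G (\<Gamma> \<turnstile> {#F#})"
proof (rule IG_contr_L[OF assms(1)])
  have fresh: "c \<notin> consts_seq (add_mset (Exists B) \<Gamma> \<turnstile> {#F#})"
    using assms(1,2) by (auto simp: consts_seq_simps)
  show "IG_provable G (add_mset (Exists B) \<Gamma> \<turnstile> {#F#})"
    by (rule IG_rule, rule rule.exists_L) (use fresh assms(3,4) in auto)
qed

lemma IG_exists_R: "IG_provable G (\<Gamma> \<turnstile> {#inst t B#}) \<Longrightarrow> IG_provable G (\<Gamma> \<turnstile> {#Exists B#})"
  by (rule IG_rule, rule rule.exists_R) auto

lemma IG_or_L:
  assumes "Or B D \<in># \<Gamma>" "IG_provable G (add_mset B \<Gamma> \<turnstile> {#F#})"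
    and "IG_provable G (add_mset D \<Gamma> \<turnstile> {#G#})"
  shows "IG_provable G (\<Gamma> \<turnstile> {#F#})"
  using assms by (blast intro: IG_contr_L IG_provable.or_LG)

section \<open>From \<open>I\<^sub>G\<close>-proofs to classical proofs\<close>

text \<open>Weakening by formulas without constants cannot violate an eigenconstant proviso.  It
  suffices to weaken by \<open>\<bottom>\<close>, which \<open>\<bottom>\<close>-R turns into an arbitrary formula.\<close>

lemma C_weaken_R_no_consts:
  assumes "C_provable s" and W: "\<And>A. A \<in># W \<Longrightarrow> consts_fm A = {}"
  shows "C_provable (antecedent s \<turnstile> succedent s + W)"
  using assms(1)
proof (induction rule: C_provable.induct)
  case (axiom s)
  then show ?case by (intro C_provable.axiom) (auto simp: axiom_seq_def)
next
  case (rule ps s)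
  note IH = rule(2)
  from rule(1) show ?case
  proof cases
    case (imp_L B D \<Gamma> \<Delta> \<Theta>)
    \<comment> \<open>The rule adds up the succedents of its premises, so only the right premise is
      weakened; otherwise \<open>W\<close> would appear twice.\<close>
    have "C_provable (add_mset (Imp B D) \<Gamma> \<turnstile> \<Delta> + (\<Theta> + W))"
      by (rule C_provable.rule, rule rule.imp_L) (use imp_L IH in auto)
    then show ?thesis by (simp add: imp_L add.assoc)
  next
    case (forall_R c \<Gamma> B \<Delta>)
    have "C_provable (\<Gamma> \<turnstile> add_mset (Forall B) (\<Delta> + W))"
      by (rule C_provable.rule, rule rule.forall_R[of c])
        (use forall_R IH W in \<open>auto simp: consts_seq_simps\<close>)
    then show ?thesis by (simp add: forall_R)
  next
    case (exists_L c B \<Gamma> \<Delta>)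
    have "C_provable (add_mset (Exists B) \<Gamma> \<turnstile> \<Delta> + W)"
      by (rule C_provable.rule, rule rule.exists_L[of c])
        (use exists_L IH W in \<open>auto simp: consts_seq_simps\<close>)
    then show ?thesis by (simp add: exists_L)
  next
    case (contr_L B \<Gamma> \<Delta>)
    have "C_provable (add_mset B \<Gamma> \<turnstile> \<Delta> + W)"
      by (rule C_provable.rule, rule rule.contr_L) (use contr_L IH in auto)
    then show ?thesis by (simp add: contr_L)
  next
    case (contr_R \<Gamma> B \<Delta>)
    have "C_provable (\<Gamma> \<turnstile> add_mset B (\<Delta> + W))"
      by (rule C_provable.rule, rule rule.contr_R) (use contr_R IH in auto)
    then show ?thesis by (simp add: contr_R)
  next
    case (bot_R \<Gamma> \<Delta> D)
    have "C_provable (\<Gamma> \<turnstile> add_mset D (\<Delta> + W))"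
      by (rule C_provable.rule, rule rule.bot_R) (use bot_R IH in auto)
    then show ?thesis by (simp add: bot_R)
  next
    case (and_L B D \<Gamma> \<Delta>)
    have "C_provable (add_mset (And B D) \<Gamma> \<turnstile> \<Delta> + W)"
      by (rule C_provable.rule, rule rule.and_L) (use and_L IH in auto)
    then show ?thesis by (simp add: and_L)
  next
    case (and_R \<Gamma> B \<Delta> D)
    have "C_provable (\<Gamma> \<turnstile> add_mset (And B D) (\<Delta> + W))"
      by (rule C_provable.rule, rule rule.and_R) (use and_R IH in auto)
    then show ?thesis by (simp add: and_R)
  next
    case (or_R1 \<Gamma> B \<Delta> D)
    have "C_provable (\<Gamma> \<turnstile> add_mset (Or B D) (\<Delta> + W))"
      by (rule C_provable.rule, rule rule.or_R1) (use or_R1 IH in auto)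
    then show ?thesis by (simp add: or_R1)
  next
    case (or_R2 \<Gamma> D \<Delta> B)
    have "C_provable (\<Gamma> \<turnstile> add_mset (Or B D) (\<Delta> + W))"
      by (rule C_provable.rule, rule rule.or_R2) (use or_R2 IH in auto)
    then show ?thesis by (simp add: or_R2)
  next
    case (imp_R B \<Gamma> D \<Delta>)
    have "C_provable (\<Gamma> \<turnstile> add_mset (Imp B D) (\<Delta> + W))"
      by (rule C_provable.rule, rule rule.imp_R) (use imp_R IH in auto)
    then show ?thesis by (simp add: imp_R)
  next
    case (forall_L t B \<Gamma> \<Delta>)
    have "C_provable (add_mset (Forall B) \<Gamma> \<turnstile> \<Delta> + W)"
      by (rule C_provable.rule, rule rule.forall_L) (use forall_L IH in auto)
    then show ?thesis by (simp add: forall_L)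
  next
    case (exists_R \<Gamma> t B \<Delta>)
    have "C_provable (\<Gamma> \<turnstile> add_mset (Exists B) (\<Delta> + W))"
      by (rule C_provable.rule, rule rule.exists_R) (use exists_R IH in auto)
    then show ?thesis by (simp add: exists_R)
  qed
next
  case or_L
  then show ?case by (simp add: C_provable.or_L)
qed

lemma C_weaken_R:
  assumes "C_provable (\<Gamma> \<turnstile> \<Delta>)"
  shows "C_provable (\<Gamma> \<turnstile> add_mset A \<Delta>)"
  using C_weaken_R_no_consts[OF assms, of "{#Bot#}"] by (auto intro: C_bot_R)

text \<open>With a spare \<open>G\<close> on the right, \<open>res_G\<close> and the second premise
  of \<open>or_LG\<close> reduce to contraction and weakening. Eigenconstants stay legitimate
  because the strengthened proviso keeps them out of \<open>G\<close>.\<close>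

lemma IG_imp_C: "IG_provable G (\<Gamma> \<turnstile> {#F#}) \<Longrightarrow> C_provable (\<Gamma> \<turnstile> {#F, G#})"
proof (induction rule: IG_induct)
  case (axiom \<Gamma> F)
  then show ?case by (intro C_provable.axiom) (auto simp: axiom_seq_def)
next
  case (imp_L B D \<Gamma> F)
  \<comment> \<open>Both premises carry the spare \<open>G\<close>, so the conclusion holds it twice
    and is contracted.\<close>
  have "C_provable (add_mset (Imp B D) \<Gamma> \<turnstile> {#G#} + {#F, G#})"
    by (rule C_provable.rule, rule rule.imp_L) (use imp_L in auto)
  then show ?case
    using C_contr_R[of _ G "{#F#}"] by (simp add: add_mset_commute)
next
  case (forall_R c \<Gamma> B)
  show ?case
    by (rule C_provable.rule, rule rule.forall_R[of c])
      (use forall_R in \<open>auto simp: consts_seq_simps\<close>)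
next
  case (exists_L c B \<Gamma> F)
  show ?case
    by (rule C_provable.rule, rule rule.exists_L[of c])
      (use exists_L in \<open>auto simp: consts_seq_simps\<close>)
next
  case (or_LG B D \<Gamma> F)
  \<comment> \<open>Here the succedent formula and the spare copy are both \<open>G\<close>.\<close>
  from or_LG(2) have "C_provable (add_mset D \<Gamma> \<turnstile> {#G#})"
    by (rule C_contr_R)
  then show ?case
    by (rule C_provable.or_L[OF or_LG(1) C_weaken_R])
next
  case (res_G \<Gamma> F)
  then have "C_provable (\<Gamma> \<turnstile> {#G#})"
    by (rule C_contr_R)
  then show ?case by (rule C_weaken_R)
next
  case contr_L
  show ?case by (rule C_provable.rule, rule rule.contr_L) (use contr_L in auto)
next
  case and_L
  show ?case by (rule C_provable.rule, rule rule.and_L) (use and_L in auto)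
next
  case and_R
  show ?case by (rule C_provable.rule, rule rule.and_R) (use and_R in auto)
next
  case or_R1
  show ?case by (rule C_provable.rule, rule rule.or_R1) (use or_R1 in auto)
next
  case or_R2
  show ?case by (rule C_provable.rule, rule rule.or_R2) (use or_R2 in auto)
next
  case imp_R
  show ?case by (rule C_provable.rule, rule rule.imp_R) (use imp_R in auto)
next
  case forall_L
  show ?case by (rule C_provable.rule, rule rule.forall_L) (use forall_L in auto)
next
  case exists_R
  show ?case by (rule C_provable.rule, rule rule.exists_R) (use exists_R in auto)
next
  case bot_R
  then show ?case by (rule C_bot_R)
qed

section \<open>From classical proofs to \<open>I\<^sub>G\<close>-proofs\<close>

text \<open>Formulas added on the left may contain eigenconstants of the proof, so these must be
  renamed on the way; generalizing over all renamings makes the induction go through. The renaming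
  fixes the constants of \<open>G\<close> because \<open>or_LG\<close> and \<open>res_G\<close>
  refer to \<open>G\<close> itself.\<close>

lemma IG_weaken_rename:
  fixes G :: "('c, 'f, 'p) fm"
  assumes inf: "infinite (UNIV :: 'c set)" and "IG_provable G (\<Gamma> \<turnstile> {#F#})"
  shows "\<lbrakk>\<forall>c \<in> consts_fm G. \<rho> c = c; \<forall>A \<in># \<Gamma>. rename_fm \<rho> A \<in># \<Gamma>'\<rbrakk> \<Longrightarrow>
    IG_provable G (\<Gamma>' \<turnstile> {#rename_fm \<rho> F#})"
  using assms(2)
proof (induction arbitrary: \<rho> \<Gamma>' rule: IG_induct)
  case (axiom \<Gamma> F)
  from axiom(1) consider "F = Top" | "bot_or_atomic F" "F \<in># \<Gamma>"
    by (auto simp: axiom_seq_def)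
  then have "axiom_seq (\<Gamma>' \<turnstile> {#rename_fm \<rho> F#})"
  proof cases
    case 2
    then have "bot_or_atomic (rename_fm \<rho> F)" by (cases F) auto
    then show ?thesis using 2 axiom(3) by (auto simp: axiom_seq_def)
  qed (simp add: axiom_seq_def)
  then show ?case by (simp add: IG_provable.axiom)
next
  \<comment> \<open>Only membership in \<open>\<Gamma>'\<close> is required, so a second copy
    imposes no new condition.\<close>
  case contr_L
  then show ?case by simp
next
  case bot_R
  show ?case
    by (rule IG_bot_R) (use bot_R(1)[of \<rho> \<Gamma>'] bot_R(2,3) in simp)
next
  case (and_L B D \<Gamma> F)
  show ?case
    by (rule IG_and_L[of "rename_fm \<rho> B" "rename_fm \<rho> D"]) (use and_L in auto)
next
  case and_R
  then show ?case by (simp add: IG_and_R)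
next
  case or_R1
  then show ?case by (simp add: IG_or_R1)
next
  case or_R2
  then show ?case by (simp add: IG_or_R2)
next
  case (imp_L B D \<Gamma> F)
  show ?case
    by (rule IG_imp_L[of "rename_fm \<rho> B" "rename_fm \<rho> D"]; (rule imp_L)?) (use imp_L in auto)
next
  case (imp_R B D \<Gamma>)
  have "IG_provable G (add_mset (rename_fm \<rho> B) \<Gamma>' \<turnstile> {#rename_fm \<rho> D#})"
    by (rule imp_R) (use imp_R in auto)
  then show ?case by (simp add: IG_imp_R)
next
  case (forall_L t B \<Gamma> F)
  have "IG_provable G (add_mset (inst (rename_tm \<rho> t) (rename_fm \<rho> B)) \<Gamma>' \<turnstile> {#rename_fm \<rho> F#})"
    by (rule forall_L) (use forall_L in \<open>auto simp: rename_subst_fm\<close>)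
  then show ?case using forall_L by - (rule IG_forall_L[of "rename_fm \<rho> B"]; auto)
next
  case (forall_R c \<Gamma> B)
  obtain d where d: "d \<notin> consts_seq (\<Gamma>' \<turnstile> {#Forall (rename_fm \<rho> B)#})" "d \<notin> consts_fm G"
    using fresh_constant[OF inf] .
  \<comment> \<open>The old eigenconstant \<open>c\<close> may occur in \<open>\<Gamma>'\<close>, so
    it is sent to \<open>d\<close>. By the proviso on \<open>c\<close>, the new renaming agrees with
    \<open>\<rho>\<close> on the lower sequent and still fixes \<open>G\<close>.\<close>
  define \<sigma> where "\<sigma> = \<rho>(c := d)"
  have \<sigma>: "\<sigma> c = d" "\<forall>c \<in> consts_fm G. \<rho> c = c \<Longrightarrow> \<forall>c \<in> consts_fm G. \<sigma> c = c"
    using forall_R(2) by (auto simp: \<sigma>_def)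
  have fresh: "rename_fm \<sigma> A = rename_fm \<rho> A" if "A \<in># add_mset B \<Gamma>" for A
    using that forall_R(1)
    unfolding \<sigma>_def by (intro rename_fm_upd) (auto simp: consts_seq_simps)
  have "IG_provable G (\<Gamma>' \<turnstile> {#rename_fm \<sigma> (inst (Const c) B)#})"
    by (rule forall_R) (use forall_R fresh \<sigma> in auto)
  then show ?case using d fresh \<sigma> by (simp add: rename_subst_fm IG_forall_R)
next
  case (exists_L c B \<Gamma> F)
  obtain d where d: "d \<notin> consts_seq (\<Gamma>' \<turnstile> {#rename_fm \<rho> F#})" "d \<notin> consts_fm G"
    using fresh_constant[OF inf] .
  define \<sigma> where "\<sigma> = \<rho>(c := d)"
  have \<sigma>: "\<sigma> c = d" "\<forall>c \<in> consts_fm G. \<rho> c = c \<Longrightarrow> \<forall>c \<in> consts_fm G. \<sigma> c = c"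
    using exists_L(2) by (auto simp: \<sigma>_def)
  have fresh: "rename_fm \<sigma> A = rename_fm \<rho> A" if "A \<in># add_mset F (add_mset B \<Gamma>)" for A
    using that exists_L(1)
    unfolding \<sigma>_def by (intro rename_fm_upd) (auto simp: consts_seq_simps)
  have "IG_provable G (add_mset (inst (Const d) (rename_fm \<rho> B)) \<Gamma>' \<turnstile> {#rename_fm \<sigma> F#})"
    by (rule exists_L(3)) (use exists_L fresh \<sigma> in \<open>auto simp: rename_subst_fm\<close>)
  then show ?case
    using d fresh exists_L by - (rule IG_exists_L[of "rename_fm \<rho> B" _ d]; auto)
next
  case (exists_R \<Gamma> t B)
  have "IG_provable G (\<Gamma>' \<turnstile> {#rename_fm \<rho> (inst t B)#})"
    by (rule exists_R) (use exists_R in auto)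
  then show ?case by (simp add: rename_subst_fm IG_exists_R)
next
  case (or_LG B D \<Gamma> F)
  have G: "rename_fm \<rho> G = G" using or_LG by (blast intro: rename_fm_fixed)
  have "IG_provable G (add_mset (rename_fm \<rho> D) \<Gamma>' \<turnstile> {#rename_fm \<rho> G#})"
    by (rule or_LG) (use or_LG in auto)
  moreover have "IG_provable G (add_mset (rename_fm \<rho> B) \<Gamma>' \<turnstile> {#rename_fm \<rho> F#})"
    by (rule or_LG) (use or_LG in auto)
  ultimately show ?case
    using or_LG G by - (rule IG_or_L[of "rename_fm \<rho> B" "rename_fm \<rho> D"]; auto)
next
  case (res_G \<Gamma> F)
  have G: "rename_fm \<rho> G = G" using res_G by (blast intro: rename_fm_fixed)
  have "IG_provable G (\<Gamma>' \<turnstile> {#rename_fm \<rho> G#})"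
    by (rule res_G) (use res_G in auto)
  then show ?case by (simp add: G IG_provable.res_G)
qed

text \<open>The identity renaming. Comparing contexts as sets covers contraction as well.\<close>

lemma IG_weaken:
  fixes G :: "('c, 'f, 'p) fm"
  assumes "infinite (UNIV :: 'c set)" "IG_provable G (\<Gamma> \<turnstile> {#F#})" "set_mset \<Gamma> \<subseteq> set_mset \<Gamma>'"
  shows "IG_provable G (\<Gamma>' \<turnstile> {#F#})"
  using IG_weaken_rename[OF assms(1,2), of "\<lambda>c. c" \<Gamma>'] assms(3)
  by (auto simp: fm.map_ident)

section \<open>Refutation relative to \<open>G\<close>\<close>

text \<open>A Kripke-style implication from \<open>A\<close> to \<open>G\<close>, with contexts as
  worlds; quantifying over extensions builds in persistence.\<close>

definition refuted ::
  "('c, 'f, 'p) fm \<Rightarrow> ('c, 'f, 'p) fm multiset \<Rightarrow> ('c, 'f, 'p) fm \<Rightarrow> bool" where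
  "refuted G \<Gamma> A \<longleftrightarrow> (\<forall>\<Gamma>'. set_mset \<Gamma> \<subseteq> set_mset \<Gamma>' \<longrightarrow>
     IG_provable G (\<Gamma>' \<turnstile> {#A#}) \<longrightarrow> IG_provable G (\<Gamma>' \<turnstile> {#G#}))"

lemma refutedI:
  "(\<And>\<Gamma>'. set_mset \<Gamma> \<subseteq> set_mset \<Gamma>' \<Longrightarrow> IG_provable G (\<Gamma>' \<turnstile> {#A#}) \<Longrightarrow> IG_provable G (\<Gamma>' \<turnstile> {#G#})) \<Longrightarrow>
    refuted G \<Gamma> A"
  by (auto simp: refuted_def)

lemma refutedD: "refuted G \<Gamma> A \<Longrightarrow> IG_provable G (\<Gamma> \<turnstile> {#A#}) \<Longrightarrow> IG_provable G (\<Gamma> \<turnstile> {#G#})"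
  by (auto simp: refuted_def)

lemma refuted_mono: "refuted G \<Gamma> A \<Longrightarrow> set_mset \<Gamma> \<subseteq> set_mset \<Gamma>' \<Longrightarrow> refuted G \<Gamma>' A"
  unfolding refuted_def by blast

text \<open>Contravariance: a derivable step from \<open>B\<close> to \<open>A\<close> on the right
  carries a refutation of the conclusion back to the premise.\<close>

lemma refuted_anti:
  "refuted G \<Gamma> A \<Longrightarrow> (\<And>\<Gamma>'. IG_provable G (\<Gamma>' \<turnstile> {#B#}) \<Longrightarrow> IG_provable G (\<Gamma>' \<turnstile> {#A#})) \<Longrightarrow>
    refuted G \<Gamma> B"
  unfolding refuted_def by blast

text \<open>Read upwards, each right rule turns a refutation of its principal formula into what the
  premises need, and left rules are copied with succedent \<open>G\<close>. The renaming
  \<open>\<rho>\<close> acts on the classical sequent only: its eigenconstants may clash with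
  \<open>\<Gamma>'\<close> or with the target \<open>G\<close>.\<close>

lemma C_imp_IG_refuted:
  fixes G :: "('c, 'f, 'p) fm"
  assumes inf: "infinite (UNIV :: 'c set)" and "C_provable s"
  shows "\<lbrakk>\<forall>A \<in># antecedent s. D_formula A; \<forall>A \<in># succedent s. G_formula A;
    \<forall>A \<in># antecedent s. rename_fm \<rho> A \<in># \<Gamma>';
    \<forall>A \<in># succedent s. refuted G \<Gamma>' (rename_fm \<rho> A)\<rbrakk> \<Longrightarrow> IG_provable G (\<Gamma>' \<turnstile> {#G#})"
  using assms(2)
proof (induction arbitrary: \<rho> \<Gamma>' rule: C_provable.induct)
  case (axiom s)
  then obtain A where A: "A \<in># succedent s" "A = Top \<or> bot_or_atomic A \<and> A \<in># antecedent s"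
    by (auto simp: axiom_seq_def)
  have "bot_or_atomic (rename_fm \<rho> A)" if "bot_or_atomic A" using that by (cases A) auto
  then have "axiom_seq (\<Gamma>' \<turnstile> {#rename_fm \<rho> A#})"
    using A axiom(4) by (auto simp: axiom_seq_def)
  then have "IG_provable G (\<Gamma>' \<turnstile> {#rename_fm \<rho> A#})" by (simp add: IG_provable.axiom)
  then show ?case using axiom(5) A(1) by (blast intro: refutedD)
next
  case (rule ps s)
  note prems = rule(3-6)
  have IH: "IG_provable G (\<Gamma>'' \<turnstile> {#G#})"
    if "\<Gamma> \<turnstile> \<Delta> \<in> set ps" "\<forall>A \<in># \<Gamma>. D_formula A" "\<forall>A \<in># \<Delta>. G_formula A"
      "\<forall>A \<in># \<Gamma>. rename_fm \<sigma> A \<in># \<Gamma>''" "\<forall>A \<in># \<Delta>. refuted G \<Gamma>'' (rename_fm \<sigma> A)"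
    for \<Gamma> \<Delta> \<sigma> \<Gamma>''
    using rule(2) that by fastforce
  from rule(1) show ?case
  proof cases
    case (contr_L B \<Gamma> \<Delta>)
    show ?thesis by (rule IH[of "add_mset B (add_mset B \<Gamma>)" \<Delta> \<rho>])
      (use contr_L prems in auto)
  next
    case (contr_R \<Gamma> B \<Delta>)
    show ?thesis by (rule IH[of \<Gamma> "add_mset B (add_mset B \<Delta>)" \<rho>])
      (use contr_R prems in auto)
  next
    case (bot_R \<Gamma> \<Delta> D)
    \<comment> \<open>\<open>Bot\<close> yields every formula, so refuting \<open>D\<close> refutes
      it.\<close>
    have "refuted G \<Gamma>' Bot"
      by (rule refuted_anti[of _ _ "rename_fm \<rho> D"]) (use bot_R prems in \<open>auto dest: IG_bot_R\<close>)
    then show ?thesis by - (rule IH[of \<Gamma> "add_mset Bot \<Delta>" \<rho>];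
      use bot_R prems in auto)
  next
    case (and_L B D \<Gamma> \<Delta>)
    have "IG_provable G (add_mset (rename_fm \<rho> B) (add_mset (rename_fm \<rho> D) \<Gamma>') \<turnstile> {#G#})"
      by (rule IH[of "add_mset B (add_mset D (add_mset (And B D) \<Gamma>))" \<Delta> \<rho>])
        (use and_L prems in \<open>auto intro: refuted_mono[of _ \<Gamma>']\<close>)
    then show ?thesis
      using and_L prems by - (rule IG_and_L[of "rename_fm \<rho> B" "rename_fm \<rho> D"]; auto)
  next
    case (and_R \<Gamma> B \<Delta> D)
    \<comment> \<open>The premises are nested. Where \<open>B\<close> is provable, any later proof
      of \<open>D\<close> gives the refuted conjunction, so \<open>D\<close> is refuted there and
      the second premise yields \<open>G\<close>. Thus \<open>B\<close> is refuted and the first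
      premise applies.\<close>
    have "refuted G \<Gamma>' (rename_fm \<rho> B)"
    proof (rule refutedI)
      fix \<Gamma>1 assume 1: "set_mset \<Gamma>' \<subseteq> set_mset \<Gamma>1" "IG_provable G (\<Gamma>1 \<turnstile> {#rename_fm \<rho> B#})"
      have "refuted G \<Gamma>1 (rename_fm \<rho> D)"
      proof (rule refutedI)
        fix \<Gamma>2 assume 2: "set_mset \<Gamma>1 \<subseteq> set_mset \<Gamma>2" "IG_provable G (\<Gamma>2 \<turnstile> {#rename_fm \<rho> D#})"
        then have "IG_provable G (\<Gamma>2 \<turnstile> {#rename_fm \<rho> (And B D)#})"
          using IG_weaken[OF inf 1(2)] by (simp add: IG_and_R)
        moreover have "refuted G \<Gamma>2 (rename_fm \<rho> (And B D))"
          by (rule refuted_mono[of _ \<Gamma>']) (use and_R prems 1 2 in auto)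
        ultimately show "IG_provable G (\<Gamma>2 \<turnstile> {#G#})" by (rule refutedD[rotated])
      qed
      then show "IG_provable G (\<Gamma>1 \<turnstile> {#G#})"
        by - (rule IH[of \<Gamma> "add_mset D \<Delta>" \<rho>];
          use and_R prems 1 in \<open>auto intro: refuted_mono[of _ \<Gamma>']\<close>)
    qed
    then show ?thesis
      by - (rule IH[of \<Gamma> "add_mset B \<Delta>" \<rho>]; use and_R prems in auto)
  next
    case (or_R1 \<Gamma> B \<Delta> D)
    have "refuted G \<Gamma>' (rename_fm \<rho> B)"
      by (rule refuted_anti[of _ _ "rename_fm \<rho> (Or B D)"])
        (use or_R1 prems in \<open>auto intro: IG_or_R1\<close>)
    then show ?thesis by - (rule IH[of \<Gamma> "add_mset B \<Delta>" \<rho>];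
      use or_R1 prems in auto)
  next
    case (or_R2 \<Gamma> D \<Delta> B)
    have "refuted G \<Gamma>' (rename_fm \<rho> D)"
      by (rule refuted_anti[of _ _ "rename_fm \<rho> (Or B D)"])
        (use or_R2 prems in \<open>auto intro: IG_or_R2\<close>)
    then show ?thesis by - (rule IH[of \<Gamma> "add_mset D \<Delta>" \<rho>];
      use or_R2 prems in auto)
  next
    case (imp_L B D \<Gamma> \<Delta> \<Theta>)
    \<comment> \<open>Given a proof of \<open>B\<close>, the second premise supplies
      \<open>G\<close> from \<open>D\<close>, and the left implication rule combines the two into a
      proof of \<open>G\<close>.\<close>
    have "refuted G \<Gamma>' (rename_fm \<rho> B)"
    proof (rule refutedI)
      fix \<Gamma>1 assume 1: "set_mset \<Gamma>' \<subseteq> set_mset \<Gamma>1" "IG_provable G (\<Gamma>1 \<turnstile> {#rename_fm \<rho> B#})"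
      have "refuted G (add_mset (rename_fm \<rho> D) \<Gamma>1) A" if "refuted G \<Gamma>' A" for A
        using that by (rule refuted_mono) (use 1 in auto)
      then have "IG_provable G (add_mset (rename_fm \<rho> D) \<Gamma>1 \<turnstile> {#G#})"
        by - (rule IH[of "add_mset D \<Gamma>" \<Theta> \<rho>]; use imp_L prems 1 in auto)
      then show "IG_provable G (\<Gamma>1 \<turnstile> {#G#})"
        using imp_L prems 1
          IG_weaken[OF inf 1(2), of "add_mset (Imp (rename_fm \<rho> B) (rename_fm \<rho> D)) \<Gamma>1"]
        by - (rule IG_imp_L[of "rename_fm \<rho> B" "rename_fm \<rho> D"]; auto)
    qed
    then show ?thesis
      by - (rule IH[of "add_mset (Imp B D) \<Gamma>" "add_mset B \<Delta>" \<rho>];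
        use imp_L prems in auto)
  next
    case (imp_R B \<Gamma> D \<Delta>)
    let ?\<Gamma> = "add_mset (rename_fm \<rho> B) \<Gamma>'"
    have Imp: "refuted G \<Gamma>' (rename_fm \<rho> (Imp B D))" using imp_R prems by auto
    \<comment> \<open>A proof of \<open>D\<close> weakens to one under the hypothesis
      \<open>B\<close>, hence proves the refuted implication.\<close>
    have "refuted G ?\<Gamma> (rename_fm \<rho> D)"
    proof (rule refuted_anti)
      show "refuted G ?\<Gamma> (rename_fm \<rho> (Imp B D))" using Imp by (rule refuted_mono) auto
      show "IG_provable G (\<Gamma>1 \<turnstile> {#rename_fm \<rho> (Imp B D)#})"
        if "IG_provable G (\<Gamma>1 \<turnstile> {#rename_fm \<rho> D#})" for \<Gamma>1
        using IG_weaken[OF inf that, of "add_mset (rename_fm \<rho> B) \<Gamma>1"]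
        by (auto intro: IG_imp_R)
    qed
    then have "IG_provable G (?\<Gamma> \<turnstile> {#G#})"
      by - (rule IH[of "add_mset B \<Gamma>" "add_mset D \<Delta>" \<rho>];
        use imp_R prems in \<open>auto intro: refuted_mono[of _ \<Gamma>']\<close>)
    \<comment> \<open>The hypothesis \<open>B\<close> has to be discharged: \<open>res_G\<close>
      replaces \<open>G\<close> by \<open>D\<close>, the implication follows, and its refutation
      returns \<open>G\<close> without \<open>B\<close>.\<close>
    then have "IG_provable G (\<Gamma>' \<turnstile> {#rename_fm \<rho> (Imp B D)#})"
      by (auto intro: IG_imp_R IG_provable.res_G)
    with Imp show ?thesis by (rule refutedD)
  next
    case (forall_L t B \<Gamma> \<Delta>)
    have "IG_provable G (add_mset (inst (rename_tm \<rho> t) (rename_fm \<rho> B)) \<Gamma>' \<turnstile> {#G#})"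
      by (rule IH[of "add_mset (inst t B) (add_mset (Forall B) \<Gamma>)" \<Delta> \<rho>])
        (use forall_L prems in \<open>auto simp: rename_subst_fm G_D_formula_subst_fm intro: refuted_mono[of _ \<Gamma>']\<close>)
    then show ?thesis
      using forall_L prems by - (rule IG_forall_L[of "rename_fm \<rho> B"]; auto)
  next
    case (forall_R c \<Gamma> B \<Delta>)
    \<comment> \<open>A universal formula on the right is no G-formula, so the assumptions are
      contradictory.\<close>
    then show ?thesis using prems by auto
  next
    case (exists_L c B \<Gamma> \<Delta>)
    obtain d where d: "d \<notin> consts_seq (\<Gamma>' \<turnstile> {#G#})" "d \<notin> consts_fm G"
      using fresh_constant[OF inf] .
    \<comment> \<open>The classical proviso on \<open>c\<close> says nothing about
      \<open>\<Gamma>'\<close> or \<open>G\<close>; \<open>d\<close> avoids both, and the two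
      renamings agree on \<open>B\<close> and all side formulas.\<close>
    define \<sigma> where "\<sigma> = \<rho>(c := d)"
    have \<sigma>: "\<sigma> c = d" by (simp add: \<sigma>_def)
    have fresh: "rename_fm \<sigma> A = rename_fm \<rho> A" if "A \<in># add_mset B (\<Gamma> + \<Delta>)" for A
      using that exists_L(3)
      unfolding \<sigma>_def by (intro rename_fm_upd) (auto simp: consts_seq_simps)
    have "IG_provable G (add_mset (inst (Const d) (rename_fm \<rho> B)) \<Gamma>' \<turnstile> {#G#})"
      by (rule IH[of "add_mset (inst (Const c) B) \<Gamma>" \<Delta> \<sigma>])
        (use exists_L prems fresh \<sigma> in
          \<open>auto simp: rename_subst_fm G_D_formula_subst_fm intro: refuted_mono[of _ \<Gamma>']\<close>)
    then show ?thesis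
      using d exists_L prems by - (rule IG_exists_L[of "rename_fm \<rho> B" _ d]; auto)
  next
    case (exists_R \<Gamma> t B \<Delta>)
    have "refuted G \<Gamma>' (rename_fm \<rho> (inst t B))"
      by (rule refuted_anti[of _ _ "rename_fm \<rho> (Exists B)"])
        (use exists_R prems in \<open>auto simp: rename_subst_fm intro: IG_exists_R\<close>)
    then show ?thesis
      by - (rule IH[of \<Gamma> "add_mset (inst t B) \<Delta>" \<rho>];
        use exists_R prems in \<open>auto simp: G_D_formula_subst_fm\<close>)
  qed
next
  case (or_L B \<Gamma> \<Delta> D)
  have "IG_provable G (add_mset (rename_fm \<rho> B) \<Gamma>' \<turnstile> {#G#})"
    by (rule or_L.IH(1)[of \<rho>])
      (use or_L.prems in \<open>auto intro: refuted_mono[of _ \<Gamma>']\<close>)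
  moreover have "IG_provable G (add_mset (rename_fm \<rho> D) \<Gamma>' \<turnstile> {#G#})"
    by (rule or_L.IH(2)[of \<rho>])
      (use or_L.prems in \<open>auto intro: refuted_mono[of _ \<Gamma>']\<close>)
  \<comment> \<open>With succedent \<open>G\<close>, both premises of \<open>or_LG\<close> have the
    shape of the classical ones.\<close>
  ultimately show ?case
    using or_L.prems by - (rule IG_or_L[of "rename_fm \<rho> B" "rename_fm \<rho> D"]; auto)
qed

theorem theorem2:
  fixes \<Gamma> :: "('c, 'f, 'p) fm multiset" and G :: "('c, 'f, 'p) fm"
  assumes "infinite (UNIV :: 'c set)"
    and "\<forall>D \<in># \<Gamma>. D_formula D"
    and "G_formula G"
  shows "C_provable (\<Gamma> \<turnstile> {#G#}) \<longleftrightarrow> IG_provable G (\<Gamma> \<turnstile> {#G#})"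
proof
  assume "C_provable (\<Gamma> \<turnstile> {#G#})"
  \<comment> \<open>The context is \<open>\<Gamma>\<close> itself, and \<open>G\<close> is refuted
    trivially, since this only says that \<open>G\<close> leads to \<open>G\<close>.\<close>
  then show "IG_provable G (\<Gamma> \<turnstile> {#G#})"
    by (rule C_imp_IG_refuted[OF assms(1), where \<rho> = "\<lambda>c. c"])
      (use assms in \<open>auto simp: fm.map_ident refuted_def\<close>)
next
  assume "IG_provable G (\<Gamma> \<turnstile> {#G#})"
  then have "C_provable (\<Gamma> \<turnstile> {#G, G#})" by (rule IG_imp_C)
  then show "C_provable (\<Gamma> \<turnstile> {#G#})" by (rule C_contr_R)
qed

end
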